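(* Let $(X,d)$ be a complete metric space, let $\mathcal{F}=\{F_i : i\in\mathbb{N}\}$ be a countable family of contraction maps on $X$ and let $\rho=\{\rho_i : i\in\mathbb{N}\}$ be a probability sequence, i.e. $0<\rho_i<1$ and $\sum_{i=1}^\infty\rho_i=1$. If there exists a bounded invariant set for $\mathcal{F}$, then an invariant measure for $(\mathcal{F},\rho)$ exists and is unique.
   Context: A map $F:X\to X$ is a contraction if there is a constant $c$ with $0<c<1$ such that $d(F(x),F(y))\le c\,d(x,y)$ for all $x,y\in X$. A non-empty set $E\subset X$ is an invariant set for $\mathcal{F}$ if $E=\overline{\bigcup_{i=1}^\infty F_i(E)}$. An invariant measure for $(\mathcal{F},\rho)$ is a Borel probability measure $\mu$ on $X$ such that $\mu(E)=\sum_{i=1}^\infty\rho_i\,\mu(F_i^{-1}(E))$ for every Borel set $E\subset X$. *)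

theory Defs
  imports "HOL-Probability.Probability"
begin

definition contraction :: "('a::metric_space \<Rightarrow> 'a) \<Rightarrow> bool" where
  "contraction f \<longleftrightarrow>
    (\<exists>c. 0 < c \<and> c < 1 \<and> (\<forall>x y. dist (f x) (f y) \<le> c * dist x y))"

definition invariant_set :: "(nat \<Rightarrow> 'a::topological_space \<Rightarrow> 'a) \<Rightarrow> 'a set \<Rightarrow> bool" where
  "invariant_set F E \<longleftrightarrow> E \<noteq> {} \<and> E = closure (\<Union>i. F i ` E)"

(* Fixing sets \<mu> to be the Borel sets makes equality of such measures agreement on all
   Borel sets. Families are indexed from 0. *)
definition invariant_measure ::
    "(nat \<Rightarrow> 'a::topological_space \<Rightarrow> 'a) \<Rightarrow> (nat \<Rightarrow> real) \<Rightarrow> 'a measure \<Rightarrow> bool" where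
  "invariant_measure F \<rho> \<mu> \<longleftrightarrow>
    prob_space \<mu> \<and> sets \<mu> = sets borel \<and>
    (\<forall>E\<in>sets borel. (\<lambda>i. \<rho> i * measure \<mu> (F i -` E)) sums measure \<mu> E)"

end

theory Submission imports Defs begin

text \<open>
The contraction ratios \<open>c i\<close> of the maps \<open>F i\<close> may have supremum \<open>1\<close>, so iterating the maps
need not contract uniformly. What replaces uniform contraction is the mean ratio
\<open>q = (\<Sum>i. \<rho> i * c i)\<close>: it is strictly below \<open>1\<close> because every \<open>c i\<close> is, and it controls both
halves of the theorem.

Uniqueness. The transfer operator \<open>f \<mapsto> (\<lambda>x. \<Sum>i. \<rho> i * f (F i x))\<close> preserves the integral against
every invariant measure and multiplies Lipschitz constants by \<open>q\<close>. Its iterates at a Lipschitz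
function \<open>f\<close> with values in \<open>[0, 1]\<close> therefore flatten out to the constant \<open>\<integral>f d\<nu>\<close>
(\<open>integral_stationary_limit\<close>), and the values of the iterates at a point do not involve \<open>\<nu>\<close>. So all
invariant measures give \<open>f\<close> the same integral, and such functions separate finite Borel measures on
any metric space, separable or not (\<open>finite_borel_measure_eqI_lipschitz\<close>).

Existence. Draw indices \<open>i\<^sub>0, i\<^sub>1, \<dots>\<close> independently with law \<open>\<rho>\<close> and look at the points
\<open>F i\<^sub>0 (F i\<^sub>1 (\<dots> (F i\<^sub>n x)))\<close>. Consecutive points are at distance at most
\<open>c i\<^sub>0 * \<dots> * c i\<^sub>n\<close> times a bound for the distances \<open>dist x (F i x)\<close>; the products
\<open>c i\<^sub>0 * \<dots> * c i\<^sub>n\<close> have expectation \<open>q ^ (n + 1)\<close>, hence are almost surely summable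
(\<open>AE_good\<close>), and the points converge by completeness. The law of the limit is invariant
(\<open>stationary_exists\<close>), since prepending one more index \<open>i\<close> applies \<open>F i\<close> to the limit. The bounded
invariant set serves only to bound \<open>dist x (F i x)\<close> uniformly in \<open>i\<close>, by its diameter for any of
its points \<open>x\<close>.
\<close>

section \<open>Borel measures are determined by Lipschitz functions\<close>

text \<open>The functions \<open>max 0 (1 - n * infdist x C)\<close> are Lipschitz and decrease to the indicator of the closed
set \<open>C\<close>, so equal integrals give equal measures of closed sets, and these form an intersection-stable
generator of the Borel sets.\<close>

lemma finite_borel_measure_eqI_lipschitz:
  fixes \<mu> \<nu> :: "'a::metric_space measure"
  assumes "finite_measure \<mu>" "finite_measure \<nu>"
    and sets: "sets \<mu> = sets borel" "sets \<nu> = sets borel"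
    and eq: "\<And>(f :: 'a \<Rightarrow> real) L. L-lipschitz_on UNIV f \<Longrightarrow> (\<And>x. 0 \<le> f x) \<Longrightarrow> (\<And>x. f x \<le> 1)
        \<Longrightarrow> (\<integral>x. f x \<partial>\<mu>) = (\<integral>x. f x \<partial>\<nu>)"
  shows "\<mu> = \<nu>"
proof -
  interpret \<mu>: finite_measure \<mu> by fact
  interpret \<nu>: finite_measure \<nu> by fact
  have space [simp]: "space \<mu> = UNIV" "space \<nu> = UNIV"
    using sets[THEN sets_eq_imp_space_eq] by simp_all
  have conv: "(\<lambda>n. \<integral>x. max 0 (1 - real n * infdist x C) \<partial>M) \<longlonglongrightarrow> measure M C"
    if M: "finite_measure M" "sets M = sets borel" and C: "closed C" "C \<noteq> {}" for M :: "'a measure" and C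
  proof -
    interpret M: finite_measure M by fact
    have [measurable_cong]: "sets M = sets borel" by fact
    have [measurable]: "C \<in> sets borel" using C by simp
    have "(\<lambda>n. \<integral>x. max 0 (1 - real n * infdist x C) \<partial>M) \<longlonglongrightarrow> (\<integral>x. indicator C x \<partial>M)"
    proof (rule integral_dominated_convergence[where w = "\<lambda>_. 1"])
      show "AE x in M. (\<lambda>n. max 0 (1 - real n * infdist x C)) \<longlonglongrightarrow> indicator C x"
      proof (rule AE_I2)
        fix x
        show "(\<lambda>n. max 0 (1 - real n * infdist x C)) \<longlonglongrightarrow> indicator C x"
        proof (cases "x \<in> C")
          case True
          then show ?thesis by simp
        next
          case False
          then have pos: "infdist x C > 0"
            using in_closed_iff_infdist_zero[OF C] infdist_nonneg[of x C] by (simp add: less_le)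
          obtain N where N: "1 < real N * infdist x C"
            using reals_Archimedean3[OF pos] by blast
          have "max 0 (1 - real n * infdist x C) = 0" if "n \<ge> N" for n
          proof -
            have "real N * infdist x C \<le> real n * infdist x C"
              using that pos by (intro mult_right_mono) auto
            then show ?thesis using N by simp
          qed
          then have "\<forall>\<^sub>F n in sequentially. max 0 (1 - real n * infdist x C) = indicator C x"
            using False by (auto simp: eventually_sequentially)
          then show ?thesis by (rule tendsto_eventually)
        qed
      qed
      show "(\<lambda>x. max 0 (1 - real n * infdist x C)) \<in> borel_measurable M" for n
      proof -
        have "(\<lambda>x. max 0 (1 - real n * infdist x C)) \<in> borel_measurable borel"
          by (intro borel_measurable_continuous_onI continuous_intros)
        then show ?thesis using measurable_cong_sets[OF M(2) refl, of "borel :: real measure"] by blast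
      qed
      show "AE x in M. norm (max 0 (1 - real n * infdist x C)) \<le> 1" for n
        by (intro AE_I2) (simp add: infdist_nonneg)
    qed simp_all
    then show ?thesis by simp
  qed
  have closed: "emeasure \<mu> C = emeasure \<nu> C" if C: "closed C" "C \<noteq> {}" for C
  proof -
    have "(\<integral>x. max 0 (1 - real n * infdist x C) \<partial>\<mu>) = (\<integral>x. max 0 (1 - real n * infdist x C) \<partial>\<nu>)" for n
    proof (rule eq)
      show "(real n)-lipschitz_on UNIV (\<lambda>x. max 0 (1 - real n * infdist x C))"
      proof (rule lipschitz_onI)
        fix x y
        have "dist (max 0 (1 - real n * infdist x C)) (max 0 (1 - real n * infdist y C))
            \<le> \<bar>real n * infdist x C - real n * infdist y C\<bar>"
          unfolding dist_real_def by linarith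
        also have "\<dots> = real n * \<bar>infdist x C - infdist y C\<bar>"
          by (metis abs_mult abs_of_nat right_diff_distrib)
        also have "\<dots> \<le> real n * dist x y"
          by (intro mult_left_mono infdist_triangle_abs) auto
        finally show "dist (max 0 (1 - real n * infdist x C)) (max 0 (1 - real n * infdist y C))
            \<le> real n * dist x y" .
      qed simp
    qed (auto simp: infdist_nonneg)
    then have "measure \<mu> C = measure \<nu> C"
      using conv[OF assms(1) sets(1) C] conv[OF assms(2) sets(2) C] LIMSEQ_unique by simp
    then show ?thesis
      by (simp add: \<mu>.emeasure_eq_measure \<nu>.emeasure_eq_measure)
  qed
  have borel: "sets (borel :: 'a measure) = sigma_sets UNIV (Collect closed)"
    unfolding borel_eq_closed by simp
  show ?thesis
  proof (rule measure_eqI_generator_eq[where E = "Collect closed" and \<Omega> = UNIV and A = "\<lambda>_. UNIV"])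
    show "Int_stable (Collect closed :: 'a set set)"
      by (auto simp: Int_stable_def)
    show "emeasure \<mu> X = emeasure \<nu> X" if "X \<in> Collect closed" for X
      using closed[of X] that by (cases "X = {}") auto
  qed (auto simp: sets borel)
qed

lemma lipschitz_borel_measurable:
  fixes f :: "'a::metric_space \<Rightarrow> 'b::metric_space"
  assumes "L-lipschitz_on UNIV f"
  shows "f \<in> borel_measurable borel"
  by (rule borel_measurable_continuous_onI) (rule lipschitz_on_continuous_on[OF assms])

section \<open>Random iteration of contractions\<close>

text \<open>The probability sequence becomes a \<open>pmf\<close>, which provides the product measure on index streams and
turns the weighted sums over \<open>i\<close> into integrals, to which Fubini's theorem applies.\<close>

locale random_contractions =
  fixes F :: "'i::countable \<Rightarrow> 'a::complete_space \<Rightarrow> 'a" and c :: "'i \<Rightarrow> real" and p :: "'i pmf"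
  assumes dist_F: "\<And>i x y. dist (F i x) (F i y) \<le> c i * dist x y"
    and c_nonneg [simp]: "\<And>i. 0 \<le> c i"
    and c_less_1: "\<And>i. c i < 1"
begin

definition stationary :: "'a measure \<Rightarrow> bool" where
  "stationary \<nu> \<longleftrightarrow> prob_space \<nu> \<and> sets \<nu> = sets borel \<and>
    (\<forall>A\<in>sets borel. emeasure \<nu> A = (\<integral>\<^sup>+i. emeasure \<nu> (F i -` A) \<partial>measure_pmf p))"

definition mean_ratio :: real where
  "mean_ratio = measure_pmf.expectation p c"

lemma integrable_pmf_bounded:
  fixes g :: "'i \<Rightarrow> real"
  assumes "\<And>i. \<bar>g i\<bar> \<le> B"
  shows "integrable (measure_pmf p) g"
  by (rule measure_pmf.integrable_const_bound[where B = B]) (use assms in auto)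

lemma integrable_c: "integrable (measure_pmf p) c"
  by (rule integrable_pmf_bounded[where B = 1]) (use c_less_1 in \<open>auto intro: less_imp_le\<close>)

lemma mean_ratio_nonneg: "0 \<le> mean_ratio"
  by (simp add: mean_ratio_def)

text \<open>A strict pointwise inequality survives integration against a probability measure, even though the
ratios need not be bounded away from \<open>1\<close>.\<close>

lemma mean_ratio_less_1: "mean_ratio < 1"
proof -
  have "measure_pmf.expectation p c < measure_pmf.expectation p (\<lambda>_. 1)"
    by (rule measure_pmf.integral_less_AE_space)
      (use integrable_c c_less_1 in \<open>auto simp: measure_pmf.emeasure_space_1\<close>)
  then show ?thesis by (simp add: mean_ratio_def)
qed

lemma nn_integral_c: "(\<integral>\<^sup>+i. ennreal (c i) \<partial>measure_pmf p) = ennreal mean_ratio"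
  unfolding mean_ratio_def by (rule nn_integral_eq_integral) (auto simp: integrable_c)

lemma F_lipschitz: "(c i)-lipschitz_on UNIV (F i)"
  by (rule lipschitz_onI) (auto simp: dist_F)

lemma F_measurable [measurable]: "F i \<in> borel_measurable borel"
  by (rule lipschitz_borel_measurable[OF F_lipschitz])

section \<open>Uniqueness of the stationary measure\<close>

text \<open>On functions this is the dual of the operation on measures whose fixed points are the stationary
measures.\<close>

definition transfer :: "('a \<Rightarrow> real) \<Rightarrow> 'a \<Rightarrow> real" where
  "transfer f x = measure_pmf.expectation p (\<lambda>i. f (F i x))"

lemma transfer_bounds:
  assumes "\<And>x. 0 \<le> f x" "\<And>x. f x \<le> 1"
  shows "0 \<le> transfer f x" "transfer f x \<le> 1"
proof -
  show "0 \<le> transfer f x" by (simp add: transfer_def assms)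
  have "transfer f x \<le> measure_pmf.expectation p (\<lambda>_. 1)"
    unfolding transfer_def
    by (intro integral_mono integrable_pmf_bounded[where B = 1]) (auto simp: assms abs_of_nonneg)
  then show "transfer f x \<le> 1" by simp
qed

text \<open>The function \<open>f \<circ> F i\<close> has Lipschitz constant \<open>c i * L\<close>, and an average of functions has at most
the average of their constants.\<close>

lemma transfer_lipschitz:
  assumes f: "L-lipschitz_on UNIV f" "\<And>x. 0 \<le> f x" "\<And>x. f x \<le> 1"
  shows "(mean_ratio * L)-lipschitz_on UNIV (transfer f)"
proof (rule lipschitz_onI)
  have L: "0 \<le> L" using f(1) by (rule lipschitz_on_nonneg)
  fix x y
  have int: "integrable (measure_pmf p) (\<lambda>i. f (F i z))" for z
    by (intro integrable_pmf_bounded[where B = 1]) (auto simp: f abs_of_nonneg)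
  have step: "\<bar>f (F i x) - f (F i y)\<bar> \<le> c i * (L * dist x y)" for i
  proof -
    have "\<bar>f (F i x) - f (F i y)\<bar> \<le> L * dist (F i x) (F i y)"
      using lipschitz_onD[OF f(1)] by (auto simp: dist_real_def)
    also have "\<dots> \<le> L * (c i * dist x y)"
      by (intro mult_left_mono dist_F L)
    finally show ?thesis by (simp add: ac_simps)
  qed
  have "dist (transfer f x) (transfer f y)
      = \<bar>measure_pmf.expectation p (\<lambda>i. f (F i x) - f (F i y))\<bar>"
    by (simp add: transfer_def dist_real_def int)
  also have "\<dots> \<le> measure_pmf.expectation p (\<lambda>i. \<bar>f (F i x) - f (F i y)\<bar>)"
    by (rule integral_abs_bound)
  also have "\<dots> \<le> measure_pmf.expectation p (\<lambda>i. c i * (L * dist x y))"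
    by (intro integral_mono step) (auto intro!: integrable_abs Bochner_Integration.integrable_diff int integrable_c)
  also have "\<dots> = mean_ratio * L * dist x y"
    by (simp add: mean_ratio_def)
  finally show "dist (transfer f x) (transfer f y) \<le> mean_ratio * L * dist x y" .
next
  show "0 \<le> mean_ratio * L"
    using mean_ratio_nonneg lipschitz_on_nonneg[OF f(1)] by simp
qed

lemma transfer_funpow:
  assumes f: "L-lipschitz_on UNIV f" "\<And>x. 0 \<le> f x" "\<And>x. f x \<le> 1"
  shows "(mean_ratio ^ n * L)-lipschitz_on UNIV ((transfer ^^ n) f)"
    and "0 \<le> (transfer ^^ n) f x" and "(transfer ^^ n) f x \<le> 1"
proof -
  have "(mean_ratio ^ n * L)-lipschitz_on UNIV ((transfer ^^ n) f) \<and>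
      (\<forall>x. 0 \<le> (transfer ^^ n) f x \<and> (transfer ^^ n) f x \<le> 1)"
  proof (induction n)
    case (Suc n)
    then show ?case
      using transfer_lipschitz[of "mean_ratio ^ n * L" "(transfer ^^ n) f"]
        transfer_bounds[of "(transfer ^^ n) f"] by (simp add: mult.assoc)
  qed (simp add: f)
  then show "(mean_ratio ^ n * L)-lipschitz_on UNIV ((transfer ^^ n) f)"
    and "0 \<le> (transfer ^^ n) f x" and "(transfer ^^ n) f x \<le> 1"
    by auto
qed

text \<open>Stationarity says that \<open>\<nu>\<close> is the mixture of its images under the maps \<open>F i\<close>. Integrating \<open>f\<close>
against this mixture and exchanging the two integrals produces \<open>transfer f\<close>.\<close>

lemma integral_transfer:
  assumes \<nu>: "stationary \<nu>"
    and f: "f \<in> borel_measurable borel" "\<And>x. 0 \<le> f x" "\<And>x. f x \<le> 1"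
  shows "(\<integral>x. transfer f x \<partial>\<nu>) = (\<integral>x. f x \<partial>\<nu>)"
proof -
  interpret \<nu>: prob_space \<nu> using \<nu> by (simp add: stationary_def)
  have [measurable_cong]: "sets \<nu> = sets borel" using \<nu> by (simp add: stationary_def)
  have space [simp]: "space \<nu> = UNIV"
    using \<open>sets \<nu> = sets borel\<close>[THEN sets_eq_imp_space_eq] by simp
  note f(1)[measurable]
  interpret P: pair_sigma_finite "measure_pmf p" \<nu> ..
  define K where "K i = distr \<nu> borel (F i)" for i
  have K_prob: "prob_space (K i)" for i
    unfolding K_def by (rule \<nu>.prob_space_distr) simp
  have K [measurable]: "K \<in> measurable (measure_pmf p) (subprob_algebra borel)"
    using K_prob by (auto simp: space_subprob_algebra K_def prob_space_imp_subprob_space)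
  have \<nu>_eq: "\<nu> = measure_pmf p \<bind> K"
  proof (rule measure_eqI)
    show "sets \<nu> = sets (measure_pmf p \<bind> K)"
      using sets_bind[of "measure_pmf p" K borel] \<open>sets \<nu> = sets borel\<close>
      by (simp add: K_def)
    fix A assume "A \<in> sets \<nu>"
    then have A: "A \<in> sets borel" using \<open>sets \<nu> = sets borel\<close> by simp
    have "emeasure (measure_pmf p \<bind> K) A = (\<integral>\<^sup>+i. emeasure (K i) A \<partial>measure_pmf p)"
      by (rule emeasure_bind[OF _ K A]) simp
    also have "\<dots> = (\<integral>\<^sup>+i. emeasure \<nu> (F i -` A) \<partial>measure_pmf p)"
      using A by (simp add: K_def emeasure_distr)
    also have "\<dots> = emeasure \<nu> A" using \<nu> A by (simp add: stationary_def)
    finally show "emeasure \<nu> A = emeasure (measure_pmf p \<bind> K) A" by simp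
  qed
  \<comment> \<open>Joint measurability rests on countability of the index type; the space may be non-separable.\<close>
  have meas: "(\<lambda>z. f (F (fst z) (snd z))) \<in> borel_measurable (measure_pmf p \<Otimes>\<^sub>M \<nu>)"
  proof (rule measurable_compose_countable[where f = "\<lambda>i z. f (F i (snd z))" and g = fst])
    show "fst \<in> measurable (measure_pmf p \<Otimes>\<^sub>M \<nu>) (count_space UNIV)"
      using measurable_fst[of "measure_pmf p" \<nu>] by simp
  qed measurable
  have "ennreal (\<integral>x. f x \<partial>\<nu>) = (\<integral>\<^sup>+x. f x \<partial>\<nu>)"
    by (rule nn_integral_eq_integral[symmetric], rule \<nu>.integrable_const_bound[where B = 1])
      (auto simp: f abs_of_nonneg)
  also have "\<dots> = (\<integral>\<^sup>+i. \<integral>\<^sup>+x. f x \<partial>K i \<partial>measure_pmf p)"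
    by (subst \<nu>_eq, rule nn_integral_bind[OF _ K]) simp
  also have "\<dots> = (\<integral>\<^sup>+i. \<integral>\<^sup>+x. f (F i x) \<partial>\<nu> \<partial>measure_pmf p)"
    by (simp add: K_def nn_integral_distr)
  also have "\<dots> = (\<integral>\<^sup>+x. \<integral>\<^sup>+i. f (F i x) \<partial>measure_pmf p \<partial>\<nu>)"
    using P.Fubini'[of "\<lambda>i x. ennreal (f (F i x))"] meas
    by (simp add: split_beta')
  also have "\<dots> = (\<integral>\<^sup>+x. transfer f x \<partial>\<nu>)"
    unfolding transfer_def
    by (intro nn_integral_cong nn_integral_eq_integral integrable_pmf_bounded[where B = 1])
      (auto simp: f abs_of_nonneg)
  finally have "(\<integral>\<^sup>+x. transfer f x \<partial>\<nu>) = ennreal (\<integral>x. f x \<partial>\<nu>)" by simp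
  then show ?thesis
  proof (subst integral_eq_nn_integral)
    show "transfer f \<in> borel_measurable \<nu>"
    proof -
      have "(\<lambda>x. \<integral>i. f (F i x) \<partial>measure_pmf p) \<in> borel_measurable \<nu>"
        using measurable_pair_swap[OF meas]
        by (intro measure_pmf.borel_measurable_lebesgue_integral) (simp add: split_beta')
      then show ?thesis by (simp add: transfer_def[abs_def])
    qed
  qed (auto simp: transfer_bounds f)
qed

text \<open>The iterates keep the integral of \<open>f\<close> while their oscillation between \<open>x\<close> and \<open>z\<close> is at most
\<open>mean_ratio ^ n * L * dist x z\<close>. As \<open>x\<close> ranges over a possibly unbounded space this is only a pointwise
bound; since the iterates stay in \<open>[0, 1]\<close>, dominated convergence still applies. The iterates at
\<open>z\<close> do not involve \<open>\<nu>\<close>, which is what makes stationary measures unique.\<close>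

lemma integral_stationary_limit:
  assumes \<nu>: "stationary \<nu>"
    and f: "L-lipschitz_on UNIV f" "\<And>x. 0 \<le> f x" "\<And>x. f x \<le> 1"
  shows "(\<lambda>n. (transfer ^^ n) f z) \<longlonglongrightarrow> (\<integral>x. f x \<partial>\<nu>)"
proof -
  interpret \<nu>: prob_space \<nu> using \<nu> by (simp add: stationary_def)
  have [measurable_cong]: "sets \<nu> = sets borel" using \<nu> by (simp add: stationary_def)
  have meas [measurable]: "(transfer ^^ n) f \<in> borel_measurable borel" for n
    by (rule lipschitz_borel_measurable[OF transfer_funpow(1)[OF f]])
  have bound: "0 \<le> (transfer ^^ n) f x" "(transfer ^^ n) f x \<le> 1" for n x
    using transfer_funpow(2,3)[OF f] by auto
  have int: "integrable \<nu> ((transfer ^^ n) f)" for n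
    by (rule \<nu>.integrable_const_bound[where B = 1]) (auto simp: bound abs_of_nonneg)
  have inv: "(\<integral>x. (transfer ^^ n) f x \<partial>\<nu>) = (\<integral>x. f x \<partial>\<nu>)" for n
  proof (induction n)
    case (Suc n)
    then show ?case using integral_transfer[OF \<nu> meas bound, of n] by simp
  qed simp
  have "(\<lambda>n. \<integral>x. (transfer ^^ n) f x - (transfer ^^ n) f z \<partial>\<nu>) \<longlonglongrightarrow> (\<integral>x. 0 \<partial>\<nu>)"
  proof (rule integral_dominated_convergence[where w = "\<lambda>_. 1"])
    show "AE x in \<nu>. (\<lambda>n. (transfer ^^ n) f x - (transfer ^^ n) f z) \<longlonglongrightarrow> 0"
    proof (rule AE_I2)
      fix x
      have "(\<lambda>n. mean_ratio ^ n * L * dist x z) \<longlonglongrightarrow> 0 * L * dist x z"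
        by (intro tendsto_intros LIMSEQ_power_zero) (use mean_ratio_nonneg mean_ratio_less_1 in auto)
      then have lim: "(\<lambda>n. mean_ratio ^ n * L * dist x z) \<longlonglongrightarrow> 0" by simp
      show "(\<lambda>n. (transfer ^^ n) f x - (transfer ^^ n) f z) \<longlonglongrightarrow> 0"
      proof (rule Lim_null_comparison[OF _ lim], rule always_eventually, rule allI)
        fix n
        show "norm ((transfer ^^ n) f x - (transfer ^^ n) f z) \<le> mean_ratio ^ n * L * dist x z"
          using lipschitz_onD[OF transfer_funpow(1)[OF f, of n], of x z] by (simp add: dist_real_def)
      qed
    qed
    show "AE x in \<nu>. norm ((transfer ^^ n) f x - (transfer ^^ n) f z) \<le> 1" for n
    proof (rule AE_I2)
      show "norm ((transfer ^^ n) f x - (transfer ^^ n) f z) \<le> 1" for x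
        using bound[of n z] bound[of n x] by (simp add: abs_le_iff)
    qed
  qed (auto)
  then have "(\<lambda>n. (\<integral>x. f x \<partial>\<nu>) - (transfer ^^ n) f z) \<longlonglongrightarrow> 0"
    by (simp add: int inv \<nu>.prob_space)
  from tendsto_diff[OF tendsto_const[of "\<integral>x. f x \<partial>\<nu>"] this] show ?thesis by simp
qed

lemma stationary_unique:
  assumes "stationary \<mu>" "stationary \<nu>"
  shows "\<mu> = \<nu>"
proof (rule finite_borel_measure_eqI_lipschitz)
  show "finite_measure \<mu>" "finite_measure \<nu>" "sets \<mu> = sets borel" "sets \<nu> = sets borel"
    using assms by (auto simp: stationary_def prob_space_def)
  show "(\<integral>x. f x \<partial>\<mu>) = (\<integral>x. f x \<partial>\<nu>)"
    if "L-lipschitz_on UNIV f" "\<And>x. 0 \<le> f x" "\<And>x. f x \<le> 1" for L and f :: "'a \<Rightarrow> real"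
    using integral_stationary_limit[OF assms(1) that] integral_stationary_limit[OF assms(2) that]
    by (rule LIMSEQ_unique)
qed

section \<open>Existence by coding infinite index sequences\<close>

abbreviation code_measure :: "'i stream measure" where
  "code_measure \<equiv> stream_space (measure_pmf p)"

text \<open>The first index is applied last, so that later indices act ever deeper inside the composition. This
is the order in which the points converge; with the opposite order only their laws would.\<close>

primrec iterate :: "nat \<Rightarrow> 'i stream \<Rightarrow> 'a \<Rightarrow> 'a" where
  "iterate 0 \<omega> x = x"
| "iterate (Suc n) \<omega> x = F (shd \<omega>) (iterate n (stl \<omega>) x)"

primrec ratio :: "nat \<Rightarrow> 'i stream \<Rightarrow> real" where
  "ratio 0 \<omega> = 1"
| "ratio (Suc n) \<omega> = c (shd \<omega>) * ratio n (stl \<omega>)"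

lemma iterate_Suc_right: "iterate (Suc n) \<omega> x = iterate n \<omega> (F (\<omega> !! n) x)"
  by (induction n arbitrary: \<omega>) auto

lemma ratio_nonneg [simp]: "0 \<le> ratio n \<omega>"
  by (induction n arbitrary: \<omega>) auto

lemma dist_iterate: "dist (iterate n \<omega> x) (iterate n \<omega> y) \<le> ratio n \<omega> * dist x y"
proof (induction n arbitrary: \<omega>)
  case (Suc n)
  have "dist (iterate (Suc n) \<omega> x) (iterate (Suc n) \<omega> y)
      \<le> c (shd \<omega>) * dist (iterate n (stl \<omega>) x) (iterate n (stl \<omega>) y)"
    using dist_F by simp
  also have "\<dots> \<le> c (shd \<omega>) * (ratio n (stl \<omega>) * dist x y)"
    by (intro mult_left_mono Suc.IH) simp
  finally show ?case by (simp add: mult.assoc)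
qed simp

lemma shd_measurable: "shd \<in> measurable code_measure (count_space UNIV)"
  using measurable_shd[of "measure_pmf p"] by simp

lemma iterate_measurable [measurable]: "(\<lambda>\<omega>. iterate n \<omega> x) \<in> borel_measurable code_measure"
proof (induction n)
  case (Suc n)
  note this[measurable]
  show ?case unfolding iterate.simps
    by (rule measurable_compose_countable[where f = "\<lambda>i \<omega>. F i (iterate n (stl \<omega>) x)" and g = shd])
      (auto intro: shd_measurable)
qed simp

lemma ratio_measurable [measurable]: "ratio n \<in> borel_measurable code_measure"
proof (induction n)
  case (Suc n)
  note this[measurable]
  have [measurable]: "c \<in> borel_measurable (measure_pmf p)" by simp
  have "(\<lambda>\<omega>. c (shd \<omega>) * ratio n (stl \<omega>)) \<in> borel_measurable code_measure" by measurable
  then show ?case by (simp cong: measurable_cong)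
qed (simp cong: measurable_cong)

lemma prob_space_code: "prob_space code_measure"
  by (rule prob_space.prob_space_stream_space) (rule measure_pmf.prob_space_axioms)

lemma space_code [simp]: "space code_measure = UNIV"
  by (simp add: space_stream_space)

text \<open>The factors of the product are independent with mean \<open>mean_ratio\<close>; splitting off the head of the
stream makes this an induction.\<close>

lemma nn_integral_ratio: "(\<integral>\<^sup>+\<omega>. ennreal (ratio n \<omega>) \<partial>code_measure) = ennreal (mean_ratio ^ n)"
proof (induction n)
  case 0
  then show ?case using prob_space.emeasure_space_1[OF prob_space_code] by simp
next
  case (Suc n)
  have "(\<integral>\<^sup>+\<omega>. ennreal (ratio (Suc n) \<omega>) \<partial>code_measure)
      = (\<integral>\<^sup>+i. \<integral>\<^sup>+\<omega>. ennreal (ratio (Suc n) (i ## \<omega>)) \<partial>code_measure \<partial>measure_pmf p)"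
    by (rule prob_space.nn_integral_stream_space[OF measure_pmf.prob_space_axioms]) measurable
  also have "\<dots> = (\<integral>\<^sup>+i. \<integral>\<^sup>+\<omega>. ennreal (c i) * ennreal (ratio n \<omega>) \<partial>code_measure \<partial>measure_pmf p)"
    by (simp add: ennreal_mult)
  also have "\<dots> = (\<integral>\<^sup>+i. ennreal (c i) * ennreal (mean_ratio ^ n) \<partial>measure_pmf p)"
    by (subst nn_integral_cmult) (auto simp: Suc.IH)
  also have "\<dots> = ennreal (mean_ratio ^ Suc n)"
    by (subst nn_integral_multc) (auto simp: nn_integral_c mean_ratio_nonneg ennreal_mult)
  finally show ?case .
qed

text \<open>The streams along which the products of ratios are summable, expressed in \<open>ennreal\<close> so that
measurability is immediate.\<close>

definition good :: "'i stream set" where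
  "good = {\<omega>. (\<Sum>n. ennreal (ratio n \<omega>)) < top}"

lemma good_sets [measurable]: "good \<in> sets code_measure"
proof -
  have "{\<omega> \<in> space code_measure. (\<Sum>n. ennreal (ratio n \<omega>)) < top} \<in> sets code_measure"
    by measurable
  then show ?thesis by (simp add: good_def)
qed

text \<open>By monotone convergence the sum of the products has expectation \<open>\<Sum>n. mean_ratio ^ n\<close>, which is
finite, so the sum is finite almost surely.\<close>

lemma AE_good: "AE \<omega> in code_measure. \<omega> \<in> good"
proof -
  have "(\<integral>\<^sup>+\<omega>. (\<Sum>n. ennreal (ratio n \<omega>)) \<partial>code_measure) = (\<Sum>n. ennreal (mean_ratio ^ n))"
    by (subst nn_integral_suminf) (auto simp: nn_integral_ratio)
  also have "\<dots> = ennreal (\<Sum>n. mean_ratio ^ n)"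
    by (rule suminf_ennreal2)
      (use mean_ratio_nonneg mean_ratio_less_1 in \<open>auto intro: summable_geometric\<close>)
  finally have "(\<integral>\<^sup>+\<omega>. (\<Sum>n. ennreal (ratio n \<omega>)) \<partial>code_measure) \<noteq> \<infinity>" by simp
  then have "AE \<omega> in code_measure. (\<Sum>n. ennreal (ratio n \<omega>)) \<noteq> \<infinity>"
    by (rule nn_integral_noteq_infinite[rotated]) measurable
  then show ?thesis by (simp add: good_def less_top)
qed

lemma good_summable: "\<omega> \<in> good \<Longrightarrow> summable (\<lambda>n. ratio n \<omega>)"
  by (rule summable_suminf_not_top) (auto simp: good_def)

lemma good_Cons: "\<omega> \<in> good \<Longrightarrow> i ## \<omega> \<in> good"
proof -
  assume "\<omega> \<in> good"
  from good_summable[OF this] have "summable (\<lambda>n. ratio (Suc n) (i ## \<omega>))"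
    by (simp add: summable_mult)
  then have "summable (\<lambda>n. ratio n (i ## \<omega>))"
    using summable_Suc_iff[of "\<lambda>n. ratio n (i ## \<omega>)"] by blast
  then show ?thesis
    by (simp add: good_def suminf_ennreal2)
qed

text \<open>Passing from \<open>n\<close> to \<open>n + 1\<close> replaces the innermost point \<open>x\<close> by \<open>F i x\<close> for some \<open>i\<close>, a change of at
most \<open>D\<close> that the outer maps shrink by \<open>ratio n \<omega>\<close>. Summability makes the sequence Cauchy.\<close>

lemma iterate_convergent:
  assumes \<omega>: "\<omega> \<in> good" and D: "\<And>i. dist x (F i x) \<le> D"
  shows "convergent (\<lambda>n. iterate n \<omega> x)"
proof -
  have "0 \<le> D" using D[of undefined] zero_le_dist order_trans by blast
  have step: "dist (iterate n \<omega> x) (iterate (Suc n) \<omega> x) \<le> ratio n \<omega> * D" for n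
  proof -
    have "dist (iterate n \<omega> x) (iterate (Suc n) \<omega> x) \<le> ratio n \<omega> * dist x (F (\<omega> !! n) x)"
      unfolding iterate_Suc_right by (rule dist_iterate)
    also have "\<dots> \<le> ratio n \<omega> * D" by (intro mult_left_mono D) simp
    finally show ?thesis .
  qed
  have sum: "summable (\<lambda>n. ratio n \<omega> * D)"
    using good_summable[OF \<omega>] by (rule summable_mult2)
  have tail: "dist (iterate m \<omega> x) (iterate n \<omega> x) \<le> (\<Sum>k=m..<n. ratio k \<omega> * D)" if "m \<le> n" for m n
    using that
  proof (induction n rule: dec_induct)
    case (step n)
    then show ?case
      using \<open>\<And>n. dist (iterate n \<omega> x) (iterate (Suc n) \<omega> x) \<le> ratio n \<omega> * D\<close>[of n]
        dist_triangle[of "iterate m \<omega> x" "iterate (Suc n) \<omega> x" "iterate n \<omega> x"] by simp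
  qed simp
  have "Cauchy (\<lambda>n. iterate n \<omega> x)"
  proof (rule metric_CauchyI)
    fix e :: real assume "0 < e"
    then obtain N where N: "\<And>m n. m \<ge> N \<Longrightarrow> norm (\<Sum>k=m..<n. ratio k \<omega> * D) < e"
      using sum unfolding summable_Cauchy by blast
    have less: "dist (iterate m \<omega> x) (iterate n \<omega> x) < e" if "N \<le> m" "m \<le> n" for m n
      using tail[OF that(2)] N[OF that(1), of n] by simp
    show "\<exists>M. \<forall>m\<ge>M. \<forall>n\<ge>M. dist (iterate m \<omega> x) (iterate n \<omega> x) < e"
      using less by (metis dist_commute nle_le)
  qed
  then show ?thesis by (simp add: Cauchy_convergent_iff)
qed

text \<open>The limit point is an equivariant coding: prepending \<open>i\<close> to the stream applies \<open>F i\<close> to the point.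
The product measure is unchanged when an independent index is prepended, and pushing it forward along
the coding turns this into stationarity.\<close>

lemma stationary_exists:
  assumes D: "\<And>i. dist x (F i x) \<le> D"
  shows "\<exists>\<mu>. stationary \<mu>"
proof -
  interpret S: prob_space code_measure by (rule prob_space_code)
  \<comment> \<open>The default value \<open>x\<close> off the good set lets \<open>code\<close> be an everywhere pointwise limit of
    measurable functions.\<close>
  define code where "code \<omega> = (if \<omega> \<in> good then lim (\<lambda>n. iterate n \<omega> x) else x)" for \<omega>
  have lim: "(\<lambda>n. iterate n \<omega> x) \<longlonglongrightarrow> code \<omega>" if "\<omega> \<in> good" for \<omega>
    using iterate_convergent[OF that D] that by (simp add: code_def convergent_LIMSEQ_iff)
  have code_meas [measurable]: "code \<in> borel_measurable code_measure"
  proof (rule borel_measurable_LIMSEQ_metric)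
    show "(\<lambda>\<omega>. if \<omega> \<in> good then iterate n \<omega> x else x) \<in> borel_measurable code_measure" for n
      by measurable
    show "(\<lambda>n. if \<omega> \<in> good then iterate n \<omega> x else x) \<longlonglongrightarrow> code \<omega>" for \<omega>
      using lim[of \<omega>] by (cases "\<omega> \<in> good") (auto simp: code_def)
  qed
  have code_Cons: "code (i ## \<omega>) = F i (code \<omega>)" if "\<omega> \<in> good" for i \<omega>
  proof -
    have "isCont (F i) (code \<omega>)"
      using lipschitz_on_continuous_on[OF F_lipschitz] by (simp add: continuous_on_eq_continuous_at)
    from isCont_tendsto_compose[OF this lim[OF that]]
    have "(\<lambda>n. iterate (Suc n) (i ## \<omega>) x) \<longlonglongrightarrow> F i (code \<omega>)" by simp
    moreover have "(\<lambda>n. iterate (Suc n) (i ## \<omega>) x) \<longlonglongrightarrow> code (i ## \<omega>)"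
      using lim[OF good_Cons[OF that]] by (rule LIMSEQ_Suc)
    ultimately show ?thesis using LIMSEQ_unique by blast
  qed
  define \<mu> where "\<mu> = distr code_measure borel code"
  have "emeasure \<mu> A = (\<integral>\<^sup>+i. emeasure \<mu> (F i -` A) \<partial>measure_pmf p)" if A [measurable]: "A \<in> sets borel" for A
  proof -
    have pre: "F i -` A \<in> sets borel" for i
      using measurable_sets[OF F_measurable A] by simp
    have "emeasure \<mu> A = (\<integral>\<^sup>+y. indicator A y \<partial>\<mu>)" by (simp add: \<mu>_def)
    also have "\<dots> = (\<integral>\<^sup>+\<omega>. indicator A (code \<omega>) \<partial>code_measure)"
      unfolding \<mu>_def by (rule nn_integral_distr) auto
    also have "\<dots> = (\<integral>\<^sup>+i. \<integral>\<^sup>+\<omega>. indicator A (code (i ## \<omega>)) \<partial>code_measure \<partial>measure_pmf p)"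
      by (rule prob_space.nn_integral_stream_space[OF measure_pmf.prob_space_axioms]) measurable
    also have "\<dots> = (\<integral>\<^sup>+i. \<integral>\<^sup>+\<omega>. indicator (F i -` A) (code \<omega>) \<partial>code_measure \<partial>measure_pmf p)"
    proof (rule nn_integral_cong, rule nn_integral_cong_AE)
      fix i
      show "AE \<omega> in code_measure. indicator A (code (i ## \<omega>)) = (indicator (F i -` A) (code \<omega>) :: ennreal)"
        using AE_good by eventually_elim (simp add: code_Cons indicator_def)
    qed
    also have "\<dots> = (\<integral>\<^sup>+i. \<integral>\<^sup>+y. indicator (F i -` A) y \<partial>\<mu> \<partial>measure_pmf p)"
      unfolding \<mu>_def using pre by (simp add: nn_integral_distr del: nn_integral_indicator)
    also have "\<dots> = (\<integral>\<^sup>+i. emeasure \<mu> (F i -` A) \<partial>measure_pmf p)"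
      using pre by (simp add: \<mu>_def)
    finally show ?thesis .
  qed
  then have "stationary \<mu>"
    by (auto simp: stationary_def \<mu>_def intro: S.prob_space_distr)
  then show ?thesis ..
qed

end

section \<open>Countable families of contractions with a bounded invariant set\<close>

lemma sums_iff_emeasure_eq_nn_integral:
  assumes pmf: "\<And>i. pmf p i = \<rho> i" and "prob_space \<mu>"
  shows "(\<lambda>i. \<rho> i * measure \<mu> (B i)) sums measure \<mu> A \<longleftrightarrow>
    emeasure \<mu> A = (\<integral>\<^sup>+i. emeasure \<mu> (B i) \<partial>measure_pmf p)"
proof -
  interpret prob_space \<mu> by fact
  have \<rho>: "0 \<le> \<rho> i" for i using pmf_nonneg[of p i] by (simp add: pmf)
  have "(\<integral>\<^sup>+i. emeasure \<mu> (B i) \<partial>measure_pmf p) = (\<Sum>i. ennreal (\<rho> i * measure \<mu> (B i)))"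
    by (simp add: nn_integral_measure_pmf nn_integral_count_space_nat pmf emeasure_eq_measure
        ennreal_mult \<rho>)
  moreover have "(\<lambda>i. \<rho> i * measure \<mu> (B i)) sums measure \<mu> A \<longleftrightarrow>
      ennreal (measure \<mu> A) = (\<Sum>i. ennreal (\<rho> i * measure \<mu> (B i)))"
  proof
    assume "(\<lambda>i. \<rho> i * measure \<mu> (B i)) sums measure \<mu> A"
    then show "ennreal (measure \<mu> A) = (\<Sum>i. ennreal (\<rho> i * measure \<mu> (B i)))"
      using \<rho> by (intro suminf_ennreal_eq[symmetric]) auto
  next
    assume eq: "ennreal (measure \<mu> A) = (\<Sum>i. ennreal (\<rho> i * measure \<mu> (B i)))"
    have sm: "summable (\<lambda>i. \<rho> i * measure \<mu> (B i))"
      by (rule summable_suminf_not_top) (simp_all add: \<rho> flip: eq)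
    have "ennreal (measure \<mu> A) = ennreal (\<Sum>i. \<rho> i * measure \<mu> (B i))"
      unfolding eq by (rule suminf_ennreal2[OF _ sm]) (simp add: \<rho>)
    moreover have "0 \<le> (\<Sum>i. \<rho> i * measure \<mu> (B i))"
      by (rule suminf_nonneg[OF sm]) (simp add: \<rho>)
    ultimately have "measure \<mu> A = (\<Sum>i. \<rho> i * measure \<mu> (B i))"
      by (simp only: ennreal_inj[OF measure_nonneg])
    then show "(\<lambda>i. \<rho> i * measure \<mu> (B i)) sums measure \<mu> A"
      using sm by (simp add: sums_iff)
  qed
  ultimately show ?thesis by (simp add: emeasure_eq_measure)
qed

theorem mainTheorem8:
  fixes F :: "nat \<Rightarrow> 'a::complete_space \<Rightarrow> 'a" and \<rho> :: "nat \<Rightarrow> real"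
  assumes "\<And>i. contraction (F i)"
    and "\<And>i. 0 < \<rho> i \<and> \<rho> i < 1"
    and "\<rho> sums 1"
    and "\<exists>E. bounded E \<and> invariant_set F E"
  shows "\<exists>!\<mu>. invariant_measure F \<rho> \<mu>"
proof -
  obtain c where c: "\<And>i. 0 < c i" "\<And>i. c i < 1" "\<And>i x y. dist (F i x) (F i y) \<le> c i * dist x y"
    using assms(1) unfolding contraction_def by metis
  have \<rho>: "0 \<le> \<rho> i" for i using assms(2)[of i] by simp
  have "(\<integral>\<^sup>+i. ennreal (\<rho> i) \<partial>count_space UNIV) = 1"
    using suminf_ennreal_eq[OF \<rho> assms(3)] by (simp add: nn_integral_count_space_nat)
  then have pmf: "pmf (embed_pmf \<rho>) i = \<rho> i" for i
    by (rule pmf_embed_pmf[OF \<rho>])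
  interpret random_contractions F c "embed_pmf \<rho>"
    by standard (use c in \<open>auto intro: less_imp_le\<close>)
  have inv_iff: "invariant_measure F \<rho> \<mu> \<longleftrightarrow> stationary \<mu>" for \<mu>
    unfolding invariant_measure_def stationary_def
    by (intro conj_cong refl ball_cong) (rule sums_iff_emeasure_eq_nn_integral[OF pmf])
  obtain E where E: "bounded E" "E \<noteq> {}" "E = closure (\<Union>i. F i ` E)"
    using assms(4) by (auto simp: invariant_set_def)
  then obtain x where x: "x \<in> E" by blast
  have "F i x \<in> E" for i
    using x E(3) closure_subset[of "\<Union>i. F i ` E"] by blast
  then have "dist x (F i x) \<le> diameter E" for i
    using diameter_bounded_bound[OF E(1) x] by simp
  then obtain \<mu> where "stationary \<mu>" using stationary_exists by blast
  then show ?thesis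
    unfolding inv_iff using stationary_unique by blast
qed

end
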